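(* There are constants $c,C>0$ such that for all sufficiently large $n$ and all $p,q\in(0,1)$ with $\hat p=\frac{p}{p+q}\ge c\frac{\log n}{n}$, with probability at least $1-1/n$ the flooding time of the stationary edge-MEG $\mathcal{M}(n,p,q)$ is at most $$C\left(\frac{\log n}{\log(n\hat p)}+\log\log(n\hat p)\right).$$
   Context: The edge-MEG $\mathcal{M}(n,p,q)=\{G_t\}$ on node set $[n]$: for each pair $e\in\binom{[n]}{2}$ there is an independent two-state Markov chain $X_t(e)\in\{0,1\}$ with $\Pr[X_{t+1}(e)=1\mid X_t(e)=0]=p$ and $\Pr[X_{t+1}(e)=0\mid X_t(e)=1]=q$; $G_t=([n],\{e:X_t(e)=1\})$. It is stationary when $G_0$ is drawn from the stationary distribution, which is the Erdős–Rényi graph $G_{n,\hat p}$, $\hat p=p/(p+q)$. Flooding from source $s$: $I_0=\{s\}$, $I_{t+1}=I_t\cup N_t(I_t)$ where $N_t(I)$ is the set of nodes outside $I$ adjacent in $G_t$ to some node of $I$; $T(s)$ is the first $t$ with $I_t=[n]$; the flooding time is $\max_s T(s)$. Logarithms are natural. *)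

theory Defs
  imports "HOL-Probability.Probability"
begin

definition edge_step :: "real \<Rightarrow> real \<Rightarrow> bool \<Rightarrow> bool pmf" where
  "edge_step p q x = (if x then bernoulli_pmf (1 - q) else bernoulli_pmf p)"

fun edge_traj_from :: "real \<Rightarrow> real \<Rightarrow> nat \<Rightarrow> bool \<Rightarrow> bool list pmf" where
  "edge_traj_from p q 0 x = return_pmf [x]"
| "edge_traj_from p q (Suc k) x =
     bind_pmf (edge_step p q x) (\<lambda>y. map_pmf (Cons x) (edge_traj_from p q k y))"

text \<open>Stationary trajectory: X_0 ~ Bernoulli(p/(p+q)).\<close>
definition edge_traj :: "real \<Rightarrow> real \<Rightarrow> nat \<Rightarrow> bool list pmf" where
  "edge_traj p q k = bind_pmf (bernoulli_pmf (p / (p + q))) (edge_traj_from p q k)"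

definition node_pairs :: "nat \<Rightarrow> nat set set" where
  "node_pairs n = {e. \<exists>u v. u < n \<and> v < n \<and> u \<noteq> v \<and> e = {u, v}}"

text \<open>Stationary edge-MEG M(n,p,q) observed on times 0..k: independent edge chains.\<close>
definition stat_edge_MEG :: "nat \<Rightarrow> real \<Rightarrow> real \<Rightarrow> nat \<Rightarrow> (nat set \<Rightarrow> bool list) pmf" where
  "stat_edge_MEG n p q k = Pi_pmf (node_pairs n) [] (\<lambda>_. edge_traj p q k)"

definition meg_adj :: "(nat set \<Rightarrow> bool list) \<Rightarrow> nat \<Rightarrow> nat \<Rightarrow> nat \<Rightarrow> bool" where
  "meg_adj X t u v = (u \<noteq> v \<and> t < length (X {u, v}) \<and> X {u, v} ! t)"

fun informed :: "nat \<Rightarrow> (nat set \<Rightarrow> bool list) \<Rightarrow> nat \<Rightarrow> nat \<Rightarrow> nat set" where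
  "informed n X s 0 = {s}"
| "informed n X s (Suc t) =
     informed n X s t \<union> {v. v < n \<and> v \<notin> informed n X s t \<and> (\<exists>u\<in>informed n X s t. meg_adj X t u v)}"

text \<open>Flooding time is at most T: for every source s, I_T = [n] (I_t is monotone).\<close>
definition flooding_time_le :: "nat \<Rightarrow> (nat set \<Rightarrow> bool list) \<Rightarrow> nat \<Rightarrow> bool" where
  "flooding_time_le n X T = (\<forall>s<n. informed n X s T = {..<n})"

end

theory Submission
  imports Defs "HOL-Real_Asymp.Real_Asymp"
begin

text \<open>
  By stationarity every snapshot is a $G(n, \hat p)$, so a union bound over times and vertex sets
  sidesteps the dependence between the informed set and the current graph. Chernoff shows that with
  high probability, in all snapshots, every set of size $m \le \lceil 1/\hat p \rceil$ has closed
  neighbourhood of size at least $n \min(\hat p m, 1) / 16$. Hence the set reached from $s$ grows by a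
  factor $\sqrt{n \hat p}$ per step and has size $n/16$ after about $2 \log n / \log(n \hat p)$ steps.
  Adjacency is symmetric, so the set of vertices from which a target $v$ is reached grows in the same
  way backwards in time. Any two disjoint sets of size $n/16$ are joined by an edge of the one
  snapshot in between, so $v$ is informed.
\<close>

section \<open>Stationarity and single snapshots of the edge chains\<close>

lemma bernoulli_edge_step_stationary:
  fixes p q :: real
  assumes "0 < p" "p < 1" "0 < q" "q < 1"
  shows "bind_pmf (bernoulli_pmf (p / (p + q))) (edge_step p q) = bernoulli_pmf (p / (p + q))"
proof (rule pmf_eqI)
  fix x :: bool
  define h where "h = p / (p + q)"
  have "h * (p + q) = p" using assms by (simp add: h_def)
  then have h: "0 \<le> h" "h \<le> 1" "h * p + h * q = p"
    using assms by (simp_all add: h_def distrib_left)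
  show "pmf (bind_pmf (bernoulli_pmf (p / (p + q))) (edge_step p q)) x =
      pmf (bernoulli_pmf (p / (p + q))) x"
    unfolding h_def[symmetric] using assms h
    by (cases x) (simp_all add: pmf_bind edge_step_def algebra_simps)
qed

text \<open>Conditioning on the first transition reduces time \<open>Suc t\<close> to time
  \<open>t\<close>, started after one step of the chain; the stationary law absorbs that step. Hence
  the induction over \<open>t\<close> needs \<open>k\<close> arbitrary.\<close>

lemma edge_traj_from_marginal:
  fixes p q :: real
  assumes "0 < p" "p < 1" "0 < q" "q < 1" and "t \<le> k"
  shows "bind_pmf (bernoulli_pmf (p / (p + q)))
      (\<lambda>x. map_pmf (\<lambda>xs. t < length xs \<and> xs ! t) (edge_traj_from p q k x)) =
    bernoulli_pmf (p / (p + q))"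
  using \<open>t \<le> k\<close>
proof (induction t arbitrary: k)
  case 0
  have "map_pmf (\<lambda>xs. 0 < length xs \<and> xs ! 0) (edge_traj_from p q k x) = return_pmf x" for x
    by (cases k) (simp_all add: map_bind_pmf map_pmf_comp)
  then show ?case by (simp add: bind_return_pmf')
next
  case (Suc t)
  then obtain k' where k: "k = Suc k'" "t \<le> k'" by (cases k) auto
  have "map_pmf (\<lambda>xs. Suc t < length xs \<and> xs ! Suc t) (edge_traj_from p q k x) =
      bind_pmf (edge_step p q x)
        (\<lambda>y. map_pmf (\<lambda>xs. t < length xs \<and> xs ! t) (edge_traj_from p q k' y))" for x
    by (simp add: k map_bind_pmf map_pmf_comp)
  then show ?case
    using Suc.IH[OF k(2)] bernoulli_edge_step_stationary[OF assms(1-4)]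
    by (simp flip: bind_assoc_pmf)
qed

lemma edge_traj_marginal:
  fixes p q :: real
  assumes "0 < p" "p < 1" "0 < q" "q < 1" "t \<le> k"
  shows "map_pmf (\<lambda>xs. t < length xs \<and> xs ! t) (edge_traj p q k) = bernoulli_pmf (p / (p + q))"
  using edge_traj_from_marginal[OF assms] by (simp add: edge_traj_def map_bind_pmf)

lemma finite_node_pairs: "finite (node_pairs n)"
proof (rule finite_subset)
  show "node_pairs n \<subseteq> Pow {..<n}" by (auto simp: node_pairs_def)
qed simp

text \<open>Disjointness of \<open>I\<close> and \<open>B\<close> makes the pairs {u, v} distinct
  edges, hence independent coordinates, and by stationarity each is absent at time \<open>t\<close>
  with probability 1 - p / (p + q).\<close>

lemma prob_stat_edge_MEG_no_edges:
  fixes p q :: real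
  assumes "0 < p" "p < 1" "0 < q" "q < 1" "t \<le> k"
    and I: "I \<subseteq> {..<n}" and B: "B \<subseteq> {..<n}" and disj: "I \<inter> B = {}"
  shows "measure_pmf.prob (stat_edge_MEG n p q k) {X. \<forall>u\<in>I. \<forall>v\<in>B. \<not> meg_adj X t u v} =
    (1 - p / (p + q)) ^ (card I * card B)"
proof -
  define F where "F = (\<lambda>(u, v). {u, v}) ` (I \<times> B)"
  define S where "S = {xs. \<not> (t < length xs \<and> xs ! t)}"
  have "{u, v} \<in> node_pairs n" if "u \<in> I" "v \<in> B" for u v
  proof -
    have "u < n" "v < n" "u \<noteq> v" using that I B disj by auto
    then show ?thesis unfolding node_pairs_def by blast
  qed
  then have F: "F \<subseteq> node_pairs n" by (auto simp: F_def)
  have "inj_on (\<lambda>(u, v). {u, v}) (I \<times> B)"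
    using disj by (auto simp: inj_on_def doubleton_eq_iff)
  then have card: "card F = card I * card B" by (simp add: F_def card_image card_cartesian_product)
  have "measure_pmf.prob (edge_traj p q k) S =
      measure_pmf.prob (map_pmf (\<lambda>xs. t < length xs \<and> xs ! t) (edge_traj p q k)) {False}"
    by (simp add: S_def vimage_def)
  also have "\<dots> = 1 - p / (p + q)"
    using assms(1-4) by (simp add: edge_traj_marginal[OF assms(1-5)] measure_pmf_single)
  finally have S: "measure_pmf.prob (edge_traj p q k) S = 1 - p / (p + q)" .
  \<comment> \<open>The event constrains the coordinates in \<open>F\<close> only, so it is a
    product set with \<open>UNIV\<close> in the other coordinates.\<close>
  have "{X. \<forall>u\<in>I. \<forall>v\<in>B. \<not> meg_adj X t u v} = Pi (node_pairs n) (\<lambda>e. if e \<in> F then S else UNIV)"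
    (is "?L = ?R")
  proof (intro set_eqI iffI)
    fix X assume X: "X \<in> ?L"
    have "X e \<in> S" if "e \<in> F" for e
      using that X disj by (auto simp: F_def S_def meg_adj_def)
    then show "X \<in> ?R" by auto
  next
    fix X assume X: "X \<in> ?R"
    have "X {u, v} \<in> S" if "u \<in> I" "v \<in> B" for u v
    proof -
      have "{u, v} \<in> F" using that by (auto simp: F_def)
      then show ?thesis using X F by (auto simp: Pi_iff split: if_splits)
    qed
    then show "X \<in> ?L" by (auto simp: S_def meg_adj_def)
  qed
  then have "measure_pmf.prob (stat_edge_MEG n p q k) ?L =
      (\<Prod>e\<in>node_pairs n. measure_pmf.prob (edge_traj p q k) (if e \<in> F then S else UNIV))"
    by (simp add: stat_edge_MEG_def measure_Pi_pmf_Pi finite_node_pairs)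
  also have "\<dots> = (\<Prod>e\<in>node_pairs n. if e \<in> F then 1 - p / (p + q) else 1)"
    by (intro prod.cong) (auto simp: S)
  also have "\<dots> = (1 - p / (p + q)) ^ card F"
    using F finite_node_pairs[of n] by (simp add: prod.If_cases Int_absorb1)
  finally show ?thesis by (simp add: card)
qed

section \<open>Expansion of small sets in a random graph\<close>

text \<open>Retaining \<open>I\<close> makes the operator extensive, so that iterating it yields the
  informed sets.\<close>

definition closed_nbhd :: "nat \<Rightarrow> (nat \<Rightarrow> nat \<Rightarrow> bool) \<Rightarrow> nat set \<Rightarrow> nat set" where
  "closed_nbhd n E I = I \<union> {v. v < n \<and> (\<exists>u\<in>I. E u v)}"

lemma closed_nbhd_mono: "I \<subseteq> J \<Longrightarrow> closed_nbhd n E I \<subseteq> closed_nbhd n E J"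
  by (auto simp: closed_nbhd_def)

lemma closed_nbhd_extensive: "I \<subseteq> closed_nbhd n E I"
  by (auto simp: closed_nbhd_def)

lemma closed_nbhd_subset: "I \<subseteq> {..<n} \<Longrightarrow> closed_nbhd n E I \<subseteq> {..<n}"
  by (auto simp: closed_nbhd_def)

text \<open>Follows from exp (-x) \<le> 1 / (1 + x). With x = \<open>ph\<close> times m it bounds
  from below the chance that a vertex is adjacent to a set of size m: linear in m until saturation
  at 1 / \<open>ph\<close>.\<close>

lemma one_minus_exp_minus_ge:
  fixes x :: real
  assumes "0 \<le> x"
  shows "min x 1 / 2 \<le> 1 - exp (- x)"
proof -
  have "1 + x \<le> exp x" by simp
  then have "exp (- x) \<le> 1 / (1 + x)"
    using assms by (simp add: exp_minus field_simps)
  also have "\<dots> \<le> 1 - min x 1 / 2"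
    using assms mult_left_le[of x x] by (auto simp: min_def field_simps)
  finally show ?thesis by simp
qed

text \<open>Stands in for ``$E$ is distributed as $G(n, \hat p)$'': Chernoff and union bounds need no more.\<close>

definition gnp_nonedges ::
  "nat \<Rightarrow> real \<Rightarrow> 'a pmf \<Rightarrow> ('a \<Rightarrow> nat \<Rightarrow> nat \<Rightarrow> bool) \<Rightarrow> bool" where
  "gnp_nonedges n ph Q E \<longleftrightarrow> (\<forall>I B. I \<subseteq> {..<n} \<longrightarrow> B \<subseteq> {..<n} \<longrightarrow> I \<inter> B = {} \<longrightarrow>
     measure_pmf.prob Q {\<omega>. \<forall>u\<in>I. \<forall>v\<in>B. \<not> E \<omega> u v} = (1 - ph) ^ (card I * card B))"

lemma gnp_nonedgesD:
  "gnp_nonedges n ph Q E \<Longrightarrow> I \<subseteq> {..<n} \<Longrightarrow> B \<subseteq> {..<n} \<Longrightarrow> I \<inter> B = {} \<Longrightarrow>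
    measure_pmf.prob Q {\<omega>. \<forall>u\<in>I. \<forall>v\<in>B. \<not> E \<omega> u v} = (1 - ph) ^ (card I * card B)"
  by (simp add: gnp_nonedges_def)

text \<open>
  Chernoff bound: $2^{-|N(I)|}$ is a product over $v \notin I$ of $\frac12 + \frac12 [v \not\sim I]$,
  and expanding this product leaves only probabilities of having no edge between $I$ and a set $B$.
\<close>

lemma prob_small_closed_nbhd:
  fixes Q :: "'a pmf" and E :: "'a \<Rightarrow> nat \<Rightarrow> nat \<Rightarrow> bool" and ph K :: real
  assumes no_edges: "gnp_nonedges n ph Q E"
    and I: "I \<subseteq> {..<n}"
  shows "measure_pmf.prob Q {\<omega>. real (card (closed_nbhd n (E \<omega>) I)) < K} \<le>
    2 powr K * ((1 + (1 - ph) ^ card I) / 2) ^ (n - card I)"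
proof -
  define W where "W = {..<n} - I"
  have finI: "finite I" using I finite_subset by blast
  have W: "finite W" "card W = n - card I"
    using I finI by (auto simp: W_def card_Diff_subset)
  define iso where "iso v = {\<omega>. \<forall>u\<in>I. \<not> E \<omega> u v}" for v
  define D where "D B = {\<omega>. \<forall>u\<in>I. \<forall>v\<in>B. \<not> E \<omega> u v}" for B
  have D: "measure_pmf.prob Q (D B) = ((1 - ph) ^ card I) ^ card B" if "B \<subseteq> W" for B
    unfolding D_def using that I by (subst gnp_nonedgesD[OF no_edges]) (auto simp: W_def power_mult)
  have ind: "(\<Prod>v\<in>B. indicat_real (iso v) \<omega>) = indicat_real (D B) \<omega>" if "finite B" for B \<omega>
    using that by (induction B rule: finite_induct) (auto simp: iso_def D_def indicator_def)
  have integrable: "integrable (measure_pmf Q) (indicat_real A)" for A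
    by (rule measure_pmf.integrable_const_bound[where B = 1]) (auto simp: indicator_def)
  define f where "f \<omega> = (\<Prod>v\<in>W. indicat_real (iso v) \<omega> / 2 + 1 / 2)" for \<omega>
  have f_sum: "f \<omega> = (\<Sum>B\<in>Pow W. indicat_real (D B) \<omega> * (1 / 2) ^ card W)" for \<omega>
  proof -
    have "f \<omega> = (\<Sum>B\<in>Pow W. (\<Prod>v\<in>B. indicat_real (iso v) \<omega> / 2) * (\<Prod>v\<in>W - B. 1 / 2))"
      unfolding f_def by (rule prod_add[OF W(1)])
    also have "\<dots> = (\<Sum>B\<in>Pow W. indicat_real (D B) \<omega> * (1 / 2) ^ card W)"
    proof (intro sum.cong refl)
      fix B assume B: "B \<in> Pow W"
      then have fB: "finite B" using W(1) finite_subset by blast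
      have cW: "card W = card B + card (W - B)"
        using B W(1) fB by (simp add: card_Diff_subset card_mono)
      show "(\<Prod>v\<in>B. indicat_real (iso v) \<omega> / 2) * (\<Prod>v\<in>W - B. 1 / 2) =
          indicat_real (D B) \<omega> * (1 / 2) ^ card W"
        by (simp add: prod_dividef ind[OF fB] cW power_add power_divide)
    qed
    finally show ?thesis .
  qed
  have int_f: "measure_pmf.expectation Q f = ((1 + (1 - ph) ^ card I) / 2) ^ (n - card I)"
  proof -
    have "measure_pmf.expectation Q f =
        (\<Sum>B\<in>Pow W. measure_pmf.expectation Q (\<lambda>\<omega>. indicat_real (D B) \<omega> * (1 / 2) ^ card W))"
      unfolding f_sum[abs_def] by (rule Bochner_Integration.integral_sum) (simp add: integrable)
    \<comment> \<open>The probabilities of the \<open>D B\<close> are powers with exponent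
      \<open>card B\<close>, so the sum over subsets refolds into a product, as if the events
      \<open>iso v\<close> were independent.\<close>
    also have "\<dots> = (\<Sum>B\<in>Pow W. (\<Prod>v\<in>B. (1 - ph) ^ card I / 2) * (\<Prod>v\<in>W - B. 1 / 2))"
    proof (intro sum.cong refl)
      fix B assume B: "B \<in> Pow W"
      then have fB: "finite B" using W(1) finite_subset by blast
      have cW: "card W = card B + card (W - B)"
        using B W(1) fB by (simp add: card_Diff_subset card_mono)
      show "measure_pmf.expectation Q (\<lambda>\<omega>. indicat_real (D B) \<omega> * (1 / 2) ^ card W) =
          (\<Prod>v\<in>B. (1 - ph) ^ card I / 2) * (\<Prod>v\<in>W - B. 1 / 2)"
        using B by (simp add: D cW power_add power_divide)
    qed
    also have "\<dots> = (\<Prod>v\<in>W. (1 - ph) ^ card I / 2 + 1 / 2)"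
      by (rule prod_add[OF W(1), symmetric])
    finally show ?thesis by (simp add: W add_divide_distrib add.commute)
  qed
  \<comment> \<open>Markov's inequality, pointwise: a closed neighbourhood smaller than
    \<open>K\<close> leaves fewer than \<open>K\<close> factors 1/2 in \<open>f \<omega>\<close>, so
    \<open>2 powr K * f \<omega>\<close> is at least 1.\<close>
  have f_lower: "indicat_real {\<omega>. real (card (closed_nbhd n (E \<omega>) I)) < K} \<omega> \<le> 2 powr K * f \<omega>" for \<omega>
  proof (cases "real (card (closed_nbhd n (E \<omega>) I)) < K")
    case True
    define R where "R = {v\<in>W. \<omega> \<notin> iso v}"
    have "R \<subseteq> closed_nbhd n (E \<omega>) I" by (auto simp: R_def W_def iso_def closed_nbhd_def)
    moreover have "finite (closed_nbhd n (E \<omega>) I)"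
      using closed_nbhd_subset[OF I] finite_subset by blast
    ultimately have cR: "real (card R) < K"
      using True card_mono[of "closed_nbhd n (E \<omega>) I" R] by linarith
    have "f \<omega> = (\<Prod>v\<in>W. if \<omega> \<in> iso v then 1 else 1 / 2)"
      unfolding f_def by (intro prod.cong) auto
    also have "\<dots> = (1 / 2) ^ card R"
      using W(1) by (simp add: prod.If_cases R_def Int_def Collect_neg_eq[symmetric])
    finally have "2 powr K * f \<omega> = 2 powr (K - real (card R))"
      by (simp add: powr_diff powr_realpow power_divide)
    then show ?thesis using True cR by (simp add: ge_one_powr_ge_zero)
  next
    case False
    have "0 \<le> f \<omega>" unfolding f_def by (intro prod_nonneg) auto
    then show ?thesis using False by simp
  qed
  have "measure_pmf.prob Q {\<omega>. real (card (closed_nbhd n (E \<omega>) I)) < K} =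
      measure_pmf.expectation Q (indicat_real {\<omega>. real (card (closed_nbhd n (E \<omega>) I)) < K})"
    by simp
  also have "\<dots> \<le> measure_pmf.expectation Q (\<lambda>\<omega>. 2 powr K * f \<omega>)"
    by (intro integral_mono f_lower) (simp_all add: f_sum integrable)
  finally show ?thesis by (simp add: int_f)
qed

text \<open>At the threshold n\<mu>/16 the moment is at most exp (-n\<mu>/8) and the factor
  \<open>2 powr K\<close> costs at most exp (n\<mu>/16). The remaining exp (-n\<mu>/16) is small
  enough for a union bound over all sets of the same size.\<close>

lemma prob_small_closed_nbhd_le:
  fixes Q :: "'a pmf" and E :: "'a \<Rightarrow> nat \<Rightarrow> nat \<Rightarrow> bool" and ph :: real
  assumes no_edges: "gnp_nonedges n ph Q E"
    and ph: "0 < ph" "ph \<le> 1" and dense: "160 * ln (real n) \<le> real n * ph"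
    and I: "I \<subseteq> {..<n}" and half: "2 * card I \<le> n" and small: "ph * real (card I) \<le> 2"
  shows "measure_pmf.prob Q
      {\<omega>. real (card (closed_nbhd n (E \<omega>) I)) < real n * min (ph * real (card I)) 1 / 16} \<le>
    exp (- (5 * ln (real n)) * real (card I))"
proof -
  define m where "m = card I"
  define \<mu> where "\<mu> = min (ph * real m) 1"
  define a where "a = (1 - ph) ^ m"
  \<comment> \<open>Because \<open>ph * real m\<close> is at most 2, truncation at 1 loses at most a
    factor 2.\<close>
  have \<mu>: "0 \<le> \<mu>" "ph * real m / 2 \<le> \<mu>"
    using ph small by (auto simp: \<mu>_def m_def)
  have a0: "0 \<le> a" using ph by (simp add: a_def)
  have "a \<le> exp (- ph) ^ m"
    unfolding a_def using ph exp_ge_add_one_self[of "- ph"] by (intro power_mono) auto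
  also have "\<dots> = exp (- (ph * real m))" by (simp flip: exp_of_nat_mult add: mult.commute)
  finally have a: "\<mu> / 2 \<le> 1 - a"
    using one_minus_exp_minus_ge[of "ph * real m"] ph by (simp add: \<mu>_def)
  have "((1 + a) / 2) ^ (n - m) \<le> exp (- \<mu> / 4) ^ (n - m)"
  proof (intro power_mono)
    have "(1 + a) / 2 \<le> 1 + (- \<mu> / 4)" using a by simp
    also have "\<dots> \<le> exp (- \<mu> / 4)" by (rule exp_ge_add_one_self)
    finally show "(1 + a) / 2 \<le> exp (- \<mu> / 4)" .
  qed (use a0 in simp)
  also have "\<dots> = exp (- (real (n - m) * \<mu> / 4))" by (simp flip: exp_of_nat_mult)
  also have "\<dots> \<le> exp (- (real n * \<mu> / 8))"
  proof -
    have "real n / 2 \<le> real (n - m)" using half by (simp add: m_def)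
    from mult_right_mono[OF this \<mu>(1)] show ?thesis by (simp add: mult.commute)
  qed
  finally have pow: "((1 + a) / 2) ^ (n - m) \<le> exp (- (real n * \<mu> / 8))" .
  have "ln (2::real) \<le> 1" using ln_le_minus_one[of "2::real"] by simp
  then have "real n * \<mu> / 16 * ln 2 \<le> real n * \<mu> / 16" using \<mu>(1) by (intro mult_left_le) auto
  then have two: "2 powr (real n * \<mu> / 16) \<le> exp (real n * \<mu> / 16)"
    by (simp add: powr_def)
  have "measure_pmf.prob Q {\<omega>. real (card (closed_nbhd n (E \<omega>) I)) < real n * \<mu> / 16} \<le>
      2 powr (real n * \<mu> / 16) * ((1 + a) / 2) ^ (n - m)"
    unfolding a_def m_def by (rule prob_small_closed_nbhd[OF no_edges I])
  also have "\<dots> \<le> exp (real n * \<mu> / 16) * exp (- (real n * \<mu> / 8))"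
    using two pow a0 by (intro mult_mono) auto
  also have "\<dots> = exp (- (real n * \<mu> / 16))" by (simp flip: exp_add)
  \<comment> \<open>The density constant is 160 = 16 * 2 * 5: 16 from the exponent, 2 from the
    truncation, 5 for the target exponent.\<close>
  also have "\<dots> \<le> exp (- (5 * ln (real n)) * real m)"
  proof -
    have "160 * ln (real n) * real m \<le> real n * ph * real m"
      using dense by (intro mult_right_mono) auto
    moreover have "real n * (ph * real m / 2) \<le> real n * \<mu>"
      using \<mu>(2) by (intro mult_left_mono) auto
    ultimately show ?thesis by simp
  qed
  finally show ?thesis by (simp add: \<mu>_def m_def)
qed

text \<open>There are at most n^m sets of size m, each failing with probability at most n^(-5m), so
  every size m \<ge> 1 contributes at most n^(-4). Summing over at most n sizes gives n^(-3), which
  leaves room for a further union over n times.\<close>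

lemma prob_not_expanding_le:
  fixes Q :: "'a pmf" and E :: "'a \<Rightarrow> nat \<Rightarrow> nat \<Rightarrow> bool" and ph :: real
  assumes no_edges: "gnp_nonedges n ph Q E"
    and ph: "0 < ph" "ph \<le> 1" and dense: "160 * ln (real n) \<le> real n * ph"
    and M: "2 * M \<le> n" "ph * real M \<le> 2" and n: "0 < n"
  shows "measure_pmf.prob Q {\<omega>. \<exists>I\<subseteq>{..<n}. I \<noteq> {} \<and> card I \<le> M \<and>
      real (card (closed_nbhd n (E \<omega>) I)) < real n * min (ph * real (card I)) 1 / 16} \<le> 1 / real n ^ 3"
proof -
  define bad where "bad I =
    {\<omega>. real (card (closed_nbhd n (E \<omega>) I)) < real n * min (ph * real (card I)) 1 / 16}" for I
  define \<S> where "\<S> m = {I. I \<subseteq> {..<n} \<and> card I = m}" for m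
  have fin: "finite (\<S> m)" for m
    by (rule finite_subset[of _ "Pow {..<n}"]) (auto simp: \<S>_def)
  have level: "measure_pmf.prob Q (\<Union>I\<in>\<S> m. bad I) \<le> 1 / real n ^ 4" if m: "m \<in> {1..M}" for m
  proof -
    have "measure_pmf.prob Q (\<Union>I\<in>\<S> m. bad I) \<le> (\<Sum>I\<in>\<S> m. measure_pmf.prob Q (bad I))"
      by (intro measure_pmf.finite_measure_subadditive_finite fin) simp
    also have "\<dots> \<le> (\<Sum>I\<in>\<S> m. exp (- (5 * ln (real n)) * real m))"
    proof (intro sum_mono)
      fix I assume I: "I \<in> \<S> m"
      have "ph * real (card I) \<le> ph * real M"
        using I m ph by (intro mult_left_mono) (auto simp: \<S>_def)
      then show "measure_pmf.prob Q (bad I) \<le> exp (- (5 * ln (real n)) * real m)"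
        unfolding bad_def using I m M prob_small_closed_nbhd_le[OF no_edges ph dense, of I]
        by (auto simp: \<S>_def)
    qed
    also have "\<dots> = real (n choose m) * (1 / real n ^ 5) ^ m"
    proof -
      have "exp (- (5 * ln (real n)) * real m) = exp (- (5 * ln (real n))) ^ m"
        by (simp flip: exp_of_nat_mult add: mult.commute)
      also have "exp (- (5 * ln (real n))) = 1 / real n ^ 5"
        using n exp_of_nat_mult[of 5 "ln (real n)"] by (simp add: exp_minus field_simps)
      finally show ?thesis using n_subsets[of "{..<n}" m] by (simp add: \<S>_def)
    qed
    also have "\<dots> \<le> real n ^ m * (1 / real n ^ 5) ^ m"
    proof (intro mult_right_mono)
      show "real (n choose m) \<le> real n ^ m"
        using binomial_le_pow[of m n] m M(1) by (simp flip: of_nat_power)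
    qed simp
    also have "\<dots> = (1 / real n ^ 4) ^ m"
    proof -
      have "real n * (1 / real n ^ 5) = 1 / real n ^ 4" using n by (simp add: power_eq_if)
      then show ?thesis by (metis power_mult_distrib)
    qed
    also have "\<dots> \<le> (1 / real n ^ 4) ^ 1"
      using m n by (intro power_decreasing) (auto simp: divide_le_eq_1)
    finally show ?thesis by simp
  qed
  have "{\<omega>. \<exists>I\<subseteq>{..<n}. I \<noteq> {} \<and> card I \<le> M \<and>
      real (card (closed_nbhd n (E \<omega>) I)) < real n * min (ph * real (card I)) 1 / 16} \<subseteq>
      (\<Union>m\<in>{1..M}. \<Union>I\<in>\<S> m. bad I)" (is "?L \<subseteq> ?R")
  proof
    fix \<omega> assume "\<omega> \<in> ?L"
    then obtain I where I: "I \<subseteq> {..<n}" "I \<noteq> {}" "card I \<le> M" "\<omega> \<in> bad I"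
      by (auto simp: bad_def)
    then have "card I \<noteq> 0" using finite_subset[OF I(1)] by auto
    then show "\<omega> \<in> ?R" using I by (auto simp: \<S>_def intro!: bexI[of _ "card I"])
  qed
  then have "measure_pmf.prob Q ?L \<le> measure_pmf.prob Q ?R"
    by (intro measure_pmf.finite_measure_mono) auto
  also have "\<dots> \<le> (\<Sum>m\<in>{1..M}. measure_pmf.prob Q (\<Union>I\<in>\<S> m. bad I))"
    by (intro measure_pmf.finite_measure_subadditive_finite) auto
  also have "\<dots> \<le> (\<Sum>m\<in>{1..M}. 1 / real n ^ 4)" by (intro sum_mono level)
  also have "\<dots> \<le> real n * (1 / real n ^ 4)"
    using M(1) by (simp add: divide_right_mono)
  also have "\<dots> = 1 / real n ^ 3" using n by (simp add: power_eq_if)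
  finally show ?thesis .
qed

section \<open>Edges between large sets\<close>

text \<open>Union bound over at most 4^n \<le> e^(2n) pairs of sets; each pair spans at least
  n^2/256 potential edges, all of which would have to be absent.\<close>

lemma prob_separated_large_sets_le:
  fixes Q :: "'a pmf" and E :: "'a \<Rightarrow> nat \<Rightarrow> nat \<Rightarrow> bool" and ph :: real
  assumes no_edges: "gnp_nonedges n ph Q E"
    and ph: "0 < ph" "ph \<le> 1"
  shows "measure_pmf.prob Q {\<omega>. \<exists>A\<subseteq>{..<n}. \<exists>B\<subseteq>{..<n}. A \<inter> B = {} \<and>
      real n / 16 \<le> real (card A) \<and> real n / 16 \<le> real (card B) \<and> (\<forall>u\<in>A. \<forall>v\<in>B. \<not> E \<omega> u v)}
    \<le> exp (real n * (2 - real n * ph / 256))"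
proof -
  define sep where "sep = (\<lambda>(A, B). {\<omega>. \<forall>u\<in>A. \<forall>v\<in>B. \<not> E \<omega> u v})"
  define P where "P = {(A, B). A \<subseteq> {..<n} \<and> B \<subseteq> {..<n} \<and> A \<inter> B = {} \<and>
      real n / 16 \<le> real (card A) \<and> real n / 16 \<le> real (card B)}"
  have P: "P \<subseteq> Pow {..<n} \<times> Pow {..<n}" by (auto simp: P_def)
  have finP: "finite P" by (rule finite_subset[OF P]) simp
  have "{\<omega>. \<exists>A\<subseteq>{..<n}. \<exists>B\<subseteq>{..<n}. A \<inter> B = {} \<and>
      real n / 16 \<le> real (card A) \<and> real n / 16 \<le> real (card B) \<and> (\<forall>u\<in>A. \<forall>v\<in>B. \<not> E \<omega> u v)}
      = (\<Union>x\<in>P. sep x)" (is "?L = _")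
    by (auto simp: P_def sep_def)
  then have "measure_pmf.prob Q ?L \<le> (\<Sum>x\<in>P. measure_pmf.prob Q (sep x))"
    using measure_pmf.finite_measure_subadditive_finite[OF finP, of sep] by simp
  also have "\<dots> \<le> (\<Sum>x\<in>P. exp (- (real n * real n * ph / 256)))"
  proof (intro sum_mono)
    fix x assume "x \<in> P"
    then obtain A B where x: "x = (A, B)" "A \<subseteq> {..<n}" "B \<subseteq> {..<n}" "A \<inter> B = {}"
      "real n / 16 \<le> real (card A)" "real n / 16 \<le> real (card B)"
      by (auto simp: P_def)
    have "measure_pmf.prob Q (sep x) = (1 - ph) ^ (card A * card B)"
      using gnp_nonedgesD[OF no_edges x(2-4)] by (simp add: sep_def x(1))
    also have "\<dots> \<le> exp (- ph) ^ (card A * card B)"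
      using ph exp_ge_add_one_self[of "- ph"] by (intro power_mono) auto
    also have "\<dots> = exp (- (real (card A) * real (card B) * ph))"
      by (simp flip: exp_of_nat_mult)
    also have "\<dots> \<le> exp (- (real n * real n * ph / 256))"
    proof -
      have "real n / 16 * (real n / 16) \<le> real (card A) * real (card B)"
        using x by (intro mult_mono) auto
      then have "real n / 16 * (real n / 16) * ph \<le> real (card A) * real (card B) * ph"
        using ph by (intro mult_right_mono) auto
      then show ?thesis by simp
    qed
    finally show "measure_pmf.prob Q (sep x) \<le> exp (- (real n * real n * ph / 256))" .
  qed
  also have "\<dots> = real (card P) * exp (- (real n * real n * ph / 256))" by simp
  also have "\<dots> \<le> exp (2 * real n) * exp (- (real n * real n * ph / 256))"
  proof (intro mult_right_mono)
    have "card P \<le> card (Pow {..<n} \<times> Pow {..<n})" using P by (intro card_mono) auto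
    also have "\<dots> = (2 ^ n) ^ 2" by (simp add: card_cartesian_product card_Pow power2_eq_square)
    finally have "real (card P) \<le> real ((2 ^ n) ^ 2)" by (rule of_nat_mono)
    also have "\<dots> = (2 ^ n) ^ 2" by simp
    also have "\<dots> \<le> (exp 1 ^ n) ^ 2"
      using exp_ge_add_one_self[of 1] by (intro power_mono) auto
    also have "\<dots> = exp (2 * real n)" by (simp flip: exp_of_nat_mult power_mult add: mult.commute)
    finally show "real (card P) \<le> exp (2 * real n)" .
  qed simp
  also have "\<dots> = exp (real n * (2 - real n * ph / 256))"
    by (simp flip: exp_add add: algebra_simps)
  finally show ?thesis .
qed

section \<open>Deterministic spreading along a sequence of graphs\<close>

text \<open>Stated for an arbitrary sequence of graphs so that it applies to the snapshots in
  reversed order as well.\<close>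

fun spread :: "nat \<Rightarrow> (nat \<Rightarrow> nat \<Rightarrow> nat \<Rightarrow> bool) \<Rightarrow> nat \<Rightarrow> nat \<Rightarrow> nat set" where
  "spread n G s 0 = {s}"
| "spread n G s (Suc t) = closed_nbhd n (G t) (spread n G s t)"

lemma informed_eq_spread: "informed n X s t = spread n (meg_adj X) s t"
  by (induction t) (auto simp: closed_nbhd_def)

lemma spread_subset: "s < n \<Longrightarrow> spread n G s t \<subseteq> {..<n}"
  by (induction t) (simp_all add: closed_nbhd_subset)

lemma spread_mono: "t \<le> t' \<Longrightarrow> spread n G s t \<subseteq> spread n G s t'"
  by (rule lift_Suc_mono_le) (simp_all add: closed_nbhd_extensive)

lemma card_spread_mono:
  assumes "s < n" "t \<le> t'"
  shows "card (spread n G s t) \<le> card (spread n G s t')"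
  using assms spread_mono spread_subset by (metis card_mono finite_lessThan finite_subset)

text \<open>A common vertex is pushed forward in time: each step replaces it by a vertex one level
  closer to \<open>v\<close> in the reversed process, still informed from \<open>s\<close>, until
  \<open>v\<close> itself is reached at time \<open>T\<close>.\<close>

lemma spread_meets_reversed_spread:
  assumes sym: "\<And>t u v. G t u v \<Longrightarrow> G t v u" and v: "v < n" and "t \<le> T"
    and "u \<in> spread n G s t" "u \<in> spread n (\<lambda>k. G (T - 1 - k)) v (T - t)"
  shows "v \<in> spread n G s T"
  using assms(3-5)
proof (induction "T - t" arbitrary: t u)
  case 0
  then show ?case by simp
next
  case (Suc d)
  let ?J = "spread n (\<lambda>k. G (T - 1 - k)) v"
  \<comment> \<open>The reversed step from level \<open>d\<close> to level \<open>Suc d\<close> uses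
    the snapshot with index \<open>T - 1 - d = t\<close>, the same one as the forward step from
    \<open>t\<close>.\<close>
  have d: "T - Suc t = d" "T - 1 - d = t" "Suc t \<le> T" using Suc.hyps by auto
  have "u \<in> closed_nbhd n (G t) (?J d)"
    using Suc.prems(3) Suc.hyps(2) d(2) by (metis spread.simps(2))
  then obtain w where w: "w \<in> ?J d" "w = u \<or> G t w u" by (auto simp: closed_nbhd_def)
  moreover have "w < n" using w(1) spread_subset[OF v] by auto
  ultimately have "w \<in> spread n G s (Suc t)"
    using Suc.prems(2) sym by (auto simp: closed_nbhd_def)
  with w(1) d show ?case using Suc.hyps(1)[of "Suc t" w] by simp
qed

text \<open>Below size 1 / \<open>ph\<close> each step multiplies the size by at least
  \<open>n * ph / 16\<close>, hence by the square root of \<open>n * ph\<close>. So \<open>r\<close>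
  steps reach 1 / \<open>ph\<close>, and one more step reaches n/16.\<close>

lemma card_spread_ge:
  fixes ph :: real
  assumes ph: "0 < ph" and dense: "256 \<le> real n * ph" and s: "s < n"
    and expanding: "\<And>t I. t \<le> r \<Longrightarrow> I \<subseteq> {..<n} \<Longrightarrow> I \<noteq> {} \<Longrightarrow> card I \<le> nat \<lceil>1 / ph\<rceil> \<Longrightarrow>
      real n * min (ph * real (card I)) 1 / 16 \<le> real (card (closed_nbhd n (G t) I))"
    and r: "real n \<le> sqrt (real n * ph) ^ r"
  shows "real n / 16 \<le> real (card (spread n G s (Suc r)))"
proof -
  define g where "g = sqrt (real n * ph)"
  let ?S = "spread n G s"
  have g: "16 \<le> g" "g * g = real n * ph"
    using dense real_le_rsqrt[of 16 "real n * ph"] by (auto simp: g_def)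
  \<comment> \<open>Here 256 = 16^2 enters: one of the two factors \<open>g\<close> of
    \<open>n * ph\<close> pays for the 16 lost in expansion.\<close>
  have g16: "16 * g \<le> real n * ph" using g mult_right_mono[of 16 g g] by simp
  have fin: "finite (?S t)" for t using spread_subset[OF s] finite_subset by blast
  have ne: "?S t \<noteq> {}" for t using spread_mono[of 0 t n G s] by auto
  have grow: "min (g ^ t) (1 / ph) \<le> real (card (?S t))" if "t \<le> r" for t
    using that
  proof (induction t)
    case 0
    then show ?case by simp
  next
    case (Suc t)
    define m where "m = real (card (?S t))"
    have IH: "min (g ^ t) (1 / ph) \<le> m" using Suc by (simp add: m_def)
    show ?case
    proof (cases "1 / ph \<le> m")
      case True
      moreover have "m \<le> real (card (?S (Suc t)))"
        unfolding m_def using card_spread_mono[OF s, of t "Suc t" G] by simp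
      ultimately show ?thesis by linarith
    next
      case False
      then have m: "g ^ t \<le> m" "m < 1 / ph" using IH by auto
      then have "ph * m \<le> 1" using ph by (simp add: field_simps)
      moreover have "card (?S t) \<le> nat \<lceil>1 / ph\<rceil>" using m(2) unfolding m_def by linarith
      ultimately have "real n * (ph * m) / 16 \<le> real (card (?S (Suc t)))"
        using expanding[of t "?S t"] Suc.prems spread_subset[OF s] ne by (simp add: m_def)
      moreover have "16 * g * m \<le> real n * ph * m"
        using g16 by (intro mult_right_mono) (auto simp: m_def)
      moreover have "g * g ^ t \<le> g * m" using m(1) g(1) by (intro mult_left_mono) auto
      ultimately show ?thesis by simp
    qed
  qed
  have "1 / ph \<le> real n" using dense ph by (simp add: field_simps)
  with r grow[of r] have "1 / ph \<le> real (card (?S r))" by (simp add: g_def)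
  \<comment> \<open>Expansion is available only up to this size, so a subset of exactly this size is
    expanded and monotonicity transfers the bound.\<close>
  then have "nat \<lceil>1 / ph\<rceil> \<le> card (?S r)" by linarith
  then obtain I where I: "I \<subseteq> ?S r" "card I = nat \<lceil>1 / ph\<rceil>"
    using obtain_subset_with_card_n by metis
  have cI: "1 / ph \<le> real (card I)" unfolding I(2) by linarith
  then have one: "1 \<le> ph * real (card I)" using ph by (simp add: field_simps)
  have "I \<noteq> {}" using one by auto
  moreover have "I \<subseteq> {..<n}" using I(1) spread_subset[OF s] by blast
  ultimately have "real n / 16 \<le> real (card (closed_nbhd n (G r) I))"
    using expanding[of r I] I(2) one by simp
  also have "card (closed_nbhd n (G r) I) \<le> card (?S (Suc r))"
    using fin[of "Suc r"] closed_nbhd_mono[OF I(1)] by (intro card_mono) auto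
  finally show ?thesis by simp
qed

text \<open>The size cap is the point where \<open>ph * card I\<close> first reaches 1 and the lower
  bound becomes linear in n.\<close>

definition expanding :: "nat \<Rightarrow> real \<Rightarrow> (nat \<Rightarrow> nat \<Rightarrow> bool) \<Rightarrow> bool" where
  "expanding n ph E \<longleftrightarrow> (\<forall>I\<subseteq>{..<n}. I \<noteq> {} \<longrightarrow> card I \<le> nat \<lceil>1 / ph\<rceil> \<longrightarrow>
     real n * min (ph * real (card I)) 1 / 16 \<le> real (card (closed_nbhd n E I)))"

definition joins_large_sets :: "nat \<Rightarrow> (nat \<Rightarrow> nat \<Rightarrow> bool) \<Rightarrow> bool" where
  "joins_large_sets n E \<longleftrightarrow> (\<forall>A\<subseteq>{..<n}. \<forall>B\<subseteq>{..<n}. A \<inter> B = {} \<longrightarrow>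
     real n / 16 \<le> real (card A) \<longrightarrow> real n / 16 \<le> real (card B) \<longrightarrow> (\<exists>u\<in>A. \<exists>v\<in>B. E u v))"

lemma meg_adj_sym: "meg_adj X t u v \<Longrightarrow> meg_adj X t v u"
  by (simp add: meg_adj_def insert_commute)

text \<open>Snapshots 0 to r grow the set reached from \<open>s\<close>, snapshot r + 1 joins, and
  snapshots r + 2 to T - 1, read backwards, grow the set reaching \<open>v\<close>. The bound 2r + 3
  \<le> T leaves at least r + 1 of the latter.\<close>

lemma flooding_time_le_if_expanding:
  fixes ph :: real
  assumes ph: "0 < ph" and dense: "256 \<le> real n * ph"
    and r: "real n \<le> sqrt (real n * ph) ^ r" and T: "2 * r + 3 \<le> T"
    and expand: "\<And>t. t < T \<Longrightarrow> expanding n ph (meg_adj X t)"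
    and join: "joins_large_sets n (meg_adj X (Suc r))"
  shows "flooding_time_le n X T"
proof -
  have "v \<in> spread n (meg_adj X) s T" if s: "s < n" and v: "v < n" for s v
  proof -
    let ?G' = "\<lambda>k. meg_adj X (T - 1 - k)"
    define A where "A = spread n (meg_adj X) s (Suc r)"
    define d where "d = T - Suc (Suc r)"
    define B where "B = spread n ?G' v d"
    have A: "real n / 16 \<le> real (card A)" unfolding A_def
      using expand T by (intro card_spread_ge[OF ph dense s _ r]) (auto simp: expanding_def)
    have "real n / 16 \<le> real (card (spread n ?G' v (Suc r)))"
      using expand T by (intro card_spread_ge[OF ph dense v _ r]) (auto simp: expanding_def)
    also have "card (spread n ?G' v (Suc r)) \<le> card B"
      unfolding B_def d_def using T by (intro card_spread_mono v) simp
    finally have B: "real n / 16 \<le> real (card B)" by simp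
    have sub: "A \<subseteq> {..<n}" "B \<subseteq> {..<n}" unfolding A_def B_def by (intro spread_subset s v)+
    have step: "spread n (meg_adj X) s (Suc (Suc r)) = closed_nbhd n (meg_adj X (Suc r)) A"
      by (simp add: A_def)
    \<comment> \<open>If \<open>A\<close> and \<open>B\<close> already meet, a common vertex stays
      informed during the joining step.\<close>
    have "\<exists>w\<in>B. w \<in> spread n (meg_adj X) s (Suc (Suc r))"
    proof (cases "A \<inter> B = {}")
      case True
      with join A B sub have "\<exists>u\<in>A. \<exists>w\<in>B. meg_adj X (Suc r) u w"
        by (simp add: joins_large_sets_def)
      then obtain u w where "u \<in> A" "w \<in> B" "meg_adj X (Suc r) u w" by blast
      then show ?thesis using sub(2) unfolding step closed_nbhd_def by blast
    next
      case False
      then show ?thesis unfolding step closed_nbhd_def by blast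
    qed
    then obtain w where "w \<in> B" "w \<in> spread n (meg_adj X) s (Suc (Suc r))" by blast
    then show ?thesis
      using spread_meets_reversed_spread[OF meg_adj_sym v, where t = "Suc (Suc r)" and T = T] T
      by (simp add: B_def d_def)
  qed
  then show ?thesis
    unfolding flooding_time_le_def informed_eq_spread using spread_subset by blast
qed

section \<open>Union bound over times and choice of constants\<close>

text \<open>Each of the T \<le> n snapshots fails to expand with probability at most n^(-3), and the
  joining snapshot fails with probability at most n^(-2). The total 2 / n^2 is at most 1 /
  n.\<close>

lemma prob_flooding_time_le_ge:
  fixes p q :: real
  defines "ph \<equiv> p / (p + q)"
  assumes pq: "0 < p" "p < 1" "0 < q" "q < 1"
    and dense: "1024 * ln (real n) \<le> real n * ph" and n: "4 \<le> n" "1 \<le> ln (real n)"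
    and r: "real n \<le> sqrt (real n * ph) ^ r" and T: "2 * r + 3 \<le> T" "T \<le> n"
  shows "1 - 1 / real n \<le> measure_pmf.prob (stat_edge_MEG n p q T) {X. flooding_time_le n X T}"
proof -
  let ?Q = "stat_edge_MEG n p q T"
  have ph: "0 < ph" "ph \<le> 1" using pq by (auto simp: ph_def)
  have dense': "256 \<le> real n * ph" "160 * ln (real n) \<le> real n * ph" using dense n by auto
  have gnp: "gnp_nonedges n ph ?Q (\<lambda>X. meg_adj X t)" if "t \<le> T" for t
    unfolding gnp_nonedges_def ph_def using prob_stat_edge_MEG_no_edges[OF pq that] by blast
  have M: "2 * nat \<lceil>1 / ph\<rceil> \<le> n" "ph * real (nat \<lceil>1 / ph\<rceil>) \<le> 2"
  proof -
    have le: "real (nat \<lceil>1 / ph\<rceil>) \<le> 1 / ph + 1" using ph by simp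
    have "1 / ph \<le> real n / 256" using dense'(1) ph by (simp add: field_simps)
    with le n show "2 * nat \<lceil>1 / ph\<rceil> \<le> n" by linarith
    have "ph * real (nat \<lceil>1 / ph\<rceil>) \<le> ph * (1 / ph + 1)" using le ph by (intro mult_left_mono) auto
    also have "\<dots> \<le> 2" using ph by (simp add: distrib_left)
    finally show "ph * real (nat \<lceil>1 / ph\<rceil>) \<le> 2" .
  qed
  define bad where "bad t = {X. \<not> expanding n ph (meg_adj X t)}" for t
  define sep where "sep = {X. \<not> joins_large_sets n (meg_adj X (Suc r))}"
  have bad: "measure_pmf.prob ?Q (bad t) \<le> 1 / real n ^ 3" if "t < T" for t
    using prob_not_expanding_le[OF gnp ph dense'(2) M, of t] that n
    by (simp add: bad_def expanding_def not_le)
  have "measure_pmf.prob ?Q sep \<le> exp (real n * (2 - real n * ph / 256))"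
    using prob_separated_large_sets_le[OF gnp ph, of "Suc r"] T
    by (simp add: sep_def joins_large_sets_def)
  \<comment> \<open>From 1024 = 4 * 256 the bracket is at most 2 - 4 ln n, which is at most -2 ln n
    as ln n \<ge> 1.\<close>
  also have "\<dots> \<le> exp (- (2 * ln (real n)))"
  proof -
    have "real n * (2 - real n * ph / 256) \<le> real n * (- (2 * ln (real n)))"
      using dense n by (intro mult_left_mono) auto
    moreover have "1 * (2 * ln (real n)) \<le> real n * (2 * ln (real n))"
      using n by (intro mult_right_mono) auto
    ultimately show ?thesis by simp
  qed
  also have "\<dots> = 1 / real n ^ 2"
    using n exp_of_nat_mult[of 2 "ln (real n)"] by (simp add: exp_minus field_simps)
  finally have sep: "measure_pmf.prob ?Q sep \<le> 1 / real n ^ 2" .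
  have "- {X. flooding_time_le n X T} \<subseteq> (\<Union>t\<in>{..<T}. bad t) \<union> sep"
    using flooding_time_le_if_expanding[OF ph(1) dense'(1) r T(1)] by (auto simp: bad_def sep_def)
  then have "measure_pmf.prob ?Q (- {X. flooding_time_le n X T}) \<le>
      measure_pmf.prob ?Q ((\<Union>t\<in>{..<T}. bad t) \<union> sep)"
    by (intro measure_pmf.finite_measure_mono) auto
  also have "\<dots> \<le> measure_pmf.prob ?Q (\<Union>t\<in>{..<T}. bad t) + measure_pmf.prob ?Q sep"
    by (intro measure_Un_le) auto
  also have "measure_pmf.prob ?Q (\<Union>t\<in>{..<T}. bad t) \<le> (\<Sum>t<T. measure_pmf.prob ?Q (bad t))"
    by (intro measure_pmf.finite_measure_subadditive_finite) auto
  also have "\<dots> \<le> (\<Sum>t<T. 1 / real n ^ 3)" by (intro sum_mono bad) simp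
  also have "\<dots> \<le> real n * (1 / real n ^ 3)" using T(2) by (simp add: divide_right_mono)
  also have "\<dots> = 1 / real n ^ 2" using n by (simp add: power_eq_if)
  also have "1 / real n ^ 2 + measure_pmf.prob ?Q sep \<le> 1 / real n ^ 2 + 1 / real n ^ 2"
    using sep by simp
  also have "\<dots> = 2 / real n * (1 / real n)" by (simp add: power2_eq_square)
  also have "\<dots> \<le> 1 * (1 / real n)" using n by (intro mult_right_mono) auto
  finally show ?thesis
    using measure_pmf.prob_compl[of "{X. flooding_time_le n X T}" ?Q] by (simp add: Compl_eq_Diff_UNIV)
qed

text \<open>\<open>T\<close> is bounded by \<open>n\<close> to keep the union over times affordable,
  and must hold two growth phases of length about 2 ln n / ln d, the time after which powers of
  \<open>sqrt d\<close> exceed \<open>n\<close>.\<close>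

lemma ex_flooding_phase_length:
  fixes n :: nat and d :: real
  assumes d: "exp 1 \<le> d" "d \<le> real n"
    and n: "20 * ln (real n) \<le> real n"
  defines "T \<equiv> nat \<lfloor>10 * (ln (real n) / ln d + ln (ln d))\<rfloor>"
  shows "T \<le> n" "\<exists>r. real n \<le> sqrt d ^ r \<and> 2 * r + 3 \<le> T"
proof -
  define L where "L = ln (real n) / ln d"
  have d0: "0 < d" using d(1) exp_gt_zero[of "1::real"] by linarith
  have ld: "1 \<le> ln d" using d(1) d0 by (simp add: ln_ge_iff)
  have le: "ln d \<le> ln (real n)" using d d0 by simp
  have L: "1 \<le> L" "L \<le> ln (real n)" "L * ln d = ln (real n)"
    using ld le by (auto simp: L_def divide_le_eq mult_left_le)
  have ll: "0 \<le> ln (ln d)" "ln (ln d) \<le> ln (real n)"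
    using ld le ln_le_minus_one[of "ln d"] by auto
  have "10 * (L + ln (ln d)) \<le> 10 * (ln (real n) + ln (real n))"
    using L(2) ll(2) by (intro mult_left_mono add_mono) auto
  also have "\<dots> \<le> real n" using n by simp
  finally have "10 * (L + ln (ln d)) \<le> real n" .
  then show "T \<le> n" unfolding T_def L_def[symmetric] by (simp add: nat_le_iff floor_le_iff)
  define r where "r = nat \<lceil>2 * L\<rceil>"
  have r: "2 * L \<le> real r" "real r \<le> 2 * L + 1" using L(1) unfolding r_def by linarith+
  define x where "x = 10 * (L + ln (ln d))"
  have "10 * L \<le> x" unfolding x_def using ll(1) by (intro mult_left_mono) auto
  \<comment> \<open>As L \<ge> 1, 2r + 3 \<le> 4L + 5 \<le> 10L - 1, where the 1 covers the floor.
    This is where the constant 10 suffices.\<close>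
  then have "2 * real r + 3 \<le> real (nat \<lfloor>x\<rfloor>)" using r(2) L(1) by linarith
  then have "2 * real r + 3 \<le> real T" by (simp add: T_def x_def L_def)
  then have "2 * r + 3 \<le> T" by linarith
  moreover have "real n \<le> sqrt d ^ r"
  proof -
    have "ln (real n) = 2 * L * (ln d / 2)" using L(3) by simp
    also have "\<dots> \<le> real r * (ln d / 2)" using r(1) ld by (intro mult_right_mono) auto
    also have "\<dots> = ln (sqrt d ^ r)" using d0 by (simp add: ln_realpow ln_sqrt)
    finally show ?thesis using d d0 by simp
  qed
  ultimately show "\<exists>r. real n \<le> sqrt d ^ r \<and> 2 * r + 3 \<le> T" by blast
qed

theorem mainTheorem13:
  shows "\<exists>c>0. \<exists>C>0. \<exists>N. \<forall>n\<ge>N. \<forall>p q :: real.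
     0 < p \<and> p < 1 \<and> 0 < q \<and> q < 1 \<and> p / (p + q) \<ge> c * ln (real n) / real n \<longrightarrow>
     (let ph = p / (p + q);
          T = nat \<lfloor>C * (ln (real n) / ln (real n * ph) + ln (ln (real n * ph)))\<rfloor>
      in measure_pmf.prob (stat_edge_MEG n p q T) {X. flooding_time_le n X T}
           \<ge> 1 - 1 / real n)"
proof -
  have "eventually (\<lambda>n::nat. 20 * ln (real n) \<le> real n) sequentially" by real_asymp
  then obtain N where N: "\<And>n. n \<ge> N \<Longrightarrow> 20 * ln (real n) \<le> real n"
    by (auto simp: eventually_sequentially)
  \<comment> \<open>The constant 1024 serves the joining step, 10 the phase lengths, and n \<ge> 4 >
    e ensures ln n \<ge> 1.\<close>
  show ?thesis
  proof (rule exI[of _ "1024::real"], intro conjI, simp, rule exI[of _ "10::real"], intro conjI, simp,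
      rule exI[of _ "max N 4"], intro allI impI)
    fix n :: nat and p q :: real
    assume n: "max N 4 \<le> n"
      and a: "0 < p \<and> p < 1 \<and> 0 < q \<and> q < 1 \<and> 1024 * ln (real n) / real n \<le> p / (p + q)"
    define ph where "ph = p / (p + q)"
    have n4: "4 \<le> n" "20 * ln (real n) \<le> real n" using n N by auto
    have "exp 1 \<le> real n" using n4(1) exp_le by linarith
    then have ln1: "1 \<le> ln (real n)" using n4(1) by (simp add: ln_ge_iff)
    have dense: "1024 * ln (real n) \<le> real n * ph"
      using a n4 by (simp add: ph_def field_simps)
    have ph: "0 < ph" "ph \<le> 1" using a by (auto simp: ph_def)
    have d: "exp 1 \<le> real n * ph" "real n * ph \<le> real n"
      using dense ln1 ph exp_le by (auto simp: mult_left_le)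
    obtain r where r: "real n \<le> sqrt (real n * ph) ^ r"
      "2 * r + 3 \<le> nat \<lfloor>10 * (ln (real n) / ln (real n * ph) + ln (ln (real n * ph)))\<rfloor>"
      using ex_flooding_phase_length(2)[OF d n4(2)] by blast
    show "let ph = p / (p + q);
          T = nat \<lfloor>10 * (ln (real n) / ln (real n * ph) + ln (ln (real n * ph)))\<rfloor>
      in measure_pmf.prob (stat_edge_MEG n p q T) {X. flooding_time_le n X T} \<ge> 1 - 1 / real n"
      unfolding Let_def
      using a dense n4(1) ln1 r ex_flooding_phase_length(1)[OF d n4(2)] unfolding ph_def
      by (intro prob_flooding_time_le_ge) auto
  qed
qed

end
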